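(* Let $F$ be a CNF formula and let $l$ be a literal such that the single-literal clause $l$ belongs to $F$. Then $l$ is superredundant in $F$ if and only if \[ \{c \in F \mid \neg l \notin c,\ c \neq l\} \cup \{c \mid c \vee \neg l \in F\} \models l , \] where $\{c \mid c \vee \neg l \in F\}$ denotes the set of clauses $d \setminus \{\neg l\}$ for $d \in F$ with $\neg l \in d$.
   Context: A CNF formula is a finite set of clauses; a clause is a finite set of literals, read as their disjunction. Tautological clauses (containing a literal and its negation) are not allowed in formulae. Resolution: from clauses $c_1 \vee l$ and $c_2 \vee \neg l$ derive $c_1 \vee c_2$; two clauses whose resolvent would be a tautology are considered not to resolve. The resolution closure $\mathrm{ResCn}(F)$ is the set of all clauses obtainable from $F$ by zero or more resolution steps. A clause $c \in F$ is superredundant in $F$ if $\mathrm{ResCn}(F) \setminus \{c\} \models c$, and superirredundant otherwise. If $l = \neg x$ then $\neg l$ denotes $x$. *)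

theory Defs
  imports Main
begin

datatype 'a literal = Pos 'a | Neg 'a

fun neg :: "'a literal \<Rightarrow> 'a literal" where
  "neg (Pos x) = Neg x"
| "neg (Neg x) = Pos x"

type_synonym 'a clause = "'a literal set"

definition tautological :: "'a clause \<Rightarrow> bool" where
  "tautological c \<longleftrightarrow> (\<exists>l. l \<in> c \<and> neg l \<in> c)"

definition cnf :: "'a clause set \<Rightarrow> bool" where
  "cnf F \<longleftrightarrow> finite F \<and> (\<forall>c\<in>F. finite c \<and> \<not> tautological c)"

fun sat_literal :: "('a \<Rightarrow> bool) \<Rightarrow> 'a literal \<Rightarrow> bool" where
  "sat_literal I (Pos x) \<longleftrightarrow> I x"
| "sat_literal I (Neg x) \<longleftrightarrow> \<not> I x"

definition sat_clause :: "('a \<Rightarrow> bool) \<Rightarrow> 'a clause \<Rightarrow> bool" where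
  "sat_clause I c \<longleftrightarrow> (\<exists>l\<in>c. sat_literal I l)"

definition entails :: "'a clause set \<Rightarrow> 'a clause \<Rightarrow> bool" where
  "entails F c \<longleftrightarrow> (\<forall>I. (\<forall>d\<in>F. sat_clause I d) \<longrightarrow> sat_clause I c)"

text \<open>Resolving on a literal removes it: with clauses as sets, \<open>c\<^sub>1 \<or> l\<close> is a clause
  \<open>C\<close> with \<open>l \<in> C\<close> and \<open>c\<^sub>1 = C - {l}\<close>. Clauses with a tautological resolvent do not resolve.\<close>

inductive_set ResCn :: "'a clause set \<Rightarrow> 'a clause set" for F where
  base: "c \<in> F \<Longrightarrow> c \<in> ResCn F"
| resolve: "\<lbrakk>C \<in> ResCn F; D \<in> ResCn F; l \<in> C; neg l \<in> D;
    \<not> tautological ((C - {l}) \<union> (D - {neg l}))\<rbrakk>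
    \<Longrightarrow> (C - {l}) \<union> (D - {neg l}) \<in> ResCn F"

definition superredundant :: "'a clause set \<Rightarrow> 'a clause \<Rightarrow> bool" where
  "superredundant F c \<longleftrightarrow> c \<in> F \<and> entails (ResCn F - {c}) c"

end

theory Submission
  imports Defs
begin

text \<open>
  Write \<open>G\<close> for the set on the right-hand side. Its clauses belong to \<open>F\<close> or are resolvents
  of such clauses with \<open>l\<close>, and none of them is \<open>l\<close> itself, so \<open>G \<subseteq> ResCn F - {{l}}\<close>.
  Conversely, a model of \<open>G\<close> satisfies every clause of \<open>ResCn F\<close> other than \<open>l\<close>, and even
  does so by a literal different from \<open>\<not>l\<close>; this stronger property is preserved by resolution,
  also by resolution with \<open>l\<close>.
\<close>

lemma neg_neg [simp]: "neg (neg l) = l"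
  by (cases l) auto

lemma sat_literal_neg [simp]: "sat_literal I (neg l) \<longleftrightarrow> \<not> sat_literal I l"
  by (cases l) auto

lemma entails_mono: "entails F c \<Longrightarrow> F \<subseteq> G \<Longrightarrow> entails G c"
  by (auto simp: entails_def)

text \<open>A true literal of \<open>C\<close> and one of \<open>D\<close> cannot be the
  complementary pair \<open>k\<close>, \<open>neg k\<close>, so at least one of them survives the
  resolution.\<close>

lemma sat_clause_resolvent:
  assumes "sat_clause I (C - X)" "sat_clause I (D - X)"
  shows "sat_clause I ((C - {k}) \<union> (D - {neg k}) - X)"
proof -
  obtain a b where "a \<in> C - X" "sat_literal I a" "b \<in> D - X" "sat_literal I b"
    using assms by (auto simp: sat_clause_def)
  moreover from this have "a \<noteq> k \<or> b \<noteq> neg k"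
    by auto
  ultimately show ?thesis
    by (auto simp: sat_clause_def)
qed

lemma ResCn_sat_without_neg:
  assumes "c \<in> ResCn F"
    and F: "\<And>d. d \<in> F \<Longrightarrow> d = {l} \<or> sat_clause I (d - {neg l})"
  shows "c = {l} \<or> sat_clause I (c - {neg l})"
  using assms(1)
proof induction
  case (base c)
  then show ?case by (rule F)
next
  case (resolve C D k)
  have neq: "neg k \<noteq> k"
    by (cases k) auto
  consider "C = {l}" | "D = {l}" | "sat_clause I (C - {neg l})" "sat_clause I (D - {neg l})"
    using resolve.IH by blast
  then show ?case
  proof cases
    case 1
    \<comment> \<open>The resolvent is \<open>D - {neg l}\<close>, so the claim is the induction
      hypothesis for \<open>D\<close>. Case 2 is symmetric.\<close>
    then have "k = l" "D \<noteq> {l}"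
      using resolve.hyps neq by auto
    then show ?thesis
      using resolve.IH 1 by auto
  next
    case 2
    then have "k = neg l" "C \<noteq> {l}"
      using resolve.hyps neq by auto
    then show ?thesis
      using resolve.IH 2 by auto
  next
    case 3
    then show ?thesis
      by (blast intro: sat_clause_resolvent)
  qed
qed

theorem theorem2:
  fixes F :: "'a clause set" and l :: "'a literal"
  assumes "cnf F" and "{l} \<in> F"
  shows "superredundant F {l} \<longleftrightarrow>
    entails ({c \<in> F. neg l \<notin> c \<and> c \<noteq> {l}} \<union> {d - {neg l} | d. d \<in> F \<and> neg l \<in> d}) {l}"
    (is "_ \<longleftrightarrow> entails ?G {l}")
proof
  assume "entails ?G {l}"
  moreover have "?G \<subseteq> ResCn F - {{l}}"
  proof -
    have "d - {neg l} \<in> ResCn F - {{l}}" if d: "d \<in> F" "neg l \<in> d" for d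
    proof -
      have nt: "\<not> tautological d"
        using assms(1) d by (simp add: cnf_def)
      then have "\<not> tautological (({l} - {l}) \<union> (d - {neg l}))"
        by (auto simp: tautological_def)
      then have "({l} - {l}) \<union> (d - {neg l}) \<in> ResCn F"
        using assms(2) d by (intro ResCn.resolve ResCn.base) auto
      \<comment> \<open>This ensures that the resolvent differs from \<open>{l}\<close>.\<close>
      moreover have "l \<notin> d"
        using nt d by (auto simp: tautological_def)
      ultimately show ?thesis
        by auto
    qed
    then show ?thesis
      by (auto intro: ResCn.base)
  qed
  ultimately have "entails (ResCn F - {{l}}) {l}"
    by (rule entails_mono)
  with assms(2) show "superredundant F {l}"
    by (simp add: superredundant_def)
next
  assume "superredundant F {l}"
  then have ent: "entails (ResCn F - {{l}}) {l}"
    by (simp add: superredundant_def)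
  show "entails ?G {l}"
    unfolding entails_def
  proof (intro allI impI)
    fix I
    assume G: "\<forall>d\<in>?G. sat_clause I d"
    \<comment> \<open>If \<open>neg l\<close> is not in \<open>d\<close>, then
      \<open>d - {neg l}\<close> is \<open>d\<close> itself, which lies in \<open>?G\<close> unless
      it is \<open>{l}\<close>; otherwise \<open>d - {neg l}\<close> lies in
      \<open>?G\<close>.\<close>
    have "d = {l} \<or> sat_clause I (d - {neg l})" if "d \<in> F" for d
      using G that by (cases "neg l \<in> d") auto
    then have "c = {l} \<or> sat_clause I (c - {neg l})" if "c \<in> ResCn F" for c
      using that by (rule ResCn_sat_without_neg[rotated])
    then have "\<forall>c \<in> ResCn F - {{l}}. sat_clause I c"
      by (auto simp: sat_clause_def)
    with ent show "sat_clause I {l}"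
      by (simp add: entails_def)
  qed
qed

end
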